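(* Let $X\in\mathbb{R}^{n\times p}$, $\beta^*\in\mathbb{R}^p$, $\varepsilon\in\mathbb{R}^n$, $y=X\beta^*+\varepsilon$, let $h:\mathbb{R}^p\to[0,+\infty)$ be a seminorm, let $\hat\beta\in\operatorname{argmin}_{\beta\in\mathbb{R}^p}\{\|X\beta-y\|^2+2h(\beta)\}$, and let $\mathrm{NB}(\varepsilon)$ be the noise barrier of $h$. Then: (1) For any realization of the noise $\varepsilon$, $\mathrm{NB}(\varepsilon)\le\|X(\hat\beta-\beta^* )\|$. (2) If $X\beta^*=0$, then $\mathrm{NB}(\varepsilon)=\|X(\hat\beta-\beta^* )\|$. (3) If the penalty is of the form $h(\cdot)=\lambda N(\cdot)$ for some norm $N$ on $\mathbb{R}^p$ and $\lambda\ge0$, then $\mathrm{NB}(\varepsilon)$ is non-increasing with respect to $\lambda$.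
   Context: $\|\cdot\|$ is the Euclidean norm. A seminorm $h$ on $\mathbb{R}^p$ is a nonnegative function satisfying the triangle inequality and $h(a\beta)=|a|h(\beta)$ for all $a\in\mathbb{R}$, $\beta\in\mathbb{R}^p$. The noise barrier of the penalty $h$ (for the design $X$) is $$\mathrm{NB}(\varepsilon)=\sup_{u\in\mathbb{R}^p:\ \|Xu\|\le1}\bigl(\varepsilon^\top Xu-h(u)\bigr).$$ *)

theory Defs
  imports "HOL-Analysis.Analysis"
begin

definition is_seminorm :: "('a::real_vector \<Rightarrow> real) \<Rightarrow> bool" where
  "is_seminorm h \<longleftrightarrow>
     (\<forall>x. 0 \<le> h x) \<and>
     (\<forall>x y. h (x + y) \<le> h x + h y) \<and>
     (\<forall>a x. h (a *\<^sub>R x) = \<bar>a\<bar> * h x)"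

definition is_norm :: "('a::real_vector \<Rightarrow> real) \<Rightarrow> bool" where
  "is_norm N \<longleftrightarrow> is_seminorm N \<and> (\<forall>x. N x = 0 \<longrightarrow> x = 0)"

(* The supremum is taken in the reals.  For h nonnegative with h 0 = 0 (in particular for a
   seminorm) it is a genuine supremum: u = 0 is admissible, and every term is at most
   norm e by Cauchy-Schwarz. *)
definition noise_barrier ::
    "real ^ 'p ^ 'n \<Rightarrow> (real ^ 'p \<Rightarrow> real) \<Rightarrow> real ^ 'n \<Rightarrow> real" where
  "noise_barrier X h e = (SUP u\<in>{u. norm (X *v u) \<le> 1}. e \<bullet> (X *v u) - h u)"

end

theory Submission
  imports Defs
begin

text \<open>Write \<open>r = y - X \<beta>hat\<close>. Moving \<open>\<beta>hat\<close> by \<open>t u\<close> and letting \<open>t\<close> decrease to \<open>0\<close>,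
  optimality gives \<open>r \<bullet> X u \<le> h u\<close> for every \<open>u\<close>; since \<open>r = \<epsilon> - X (\<beta>hat - \<beta>star)\<close>,
  Cauchy-Schwarz yields the upper bound. If \<open>X \<beta>star = 0\<close>, moving in the direction
  \<open>- \<beta>hat\<close>, along which \<open>h\<close> is linear, gives \<open>r \<bullet> X \<beta>hat \<ge> h \<beta>hat\<close>, so that the
  normalisation of \<open>\<beta>hat\<close> attains the bound.\<close>

text \<open>Near \<open>0\<close> the linear term dominates: a negative \<open>c\<close> would make
  the expression negative for small \<open>t\<close>. One explicit \<open>t\<close> replaces the
  limit.\<close>

lemma nonneg_of_quadratic_nonneg:
  fixes c d :: real
  assumes "d \<ge> 0" and ge: "\<And>t. 0 < t \<Longrightarrow> t \<le> 1 \<Longrightarrow> 0 \<le> t * c + t\<^sup>2 * d"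
  shows "0 \<le> c"
proof (rule ccontr)
  assume "\<not> 0 \<le> c"
  then have c: "c < 0" by simp
  define t where "t = - c / (d - c)"
  have pos: "0 < d - c" using c \<open>d \<ge> 0\<close> by simp
  have t: "0 < t" "t \<le> 1"
    using c \<open>d \<ge> 0\<close> pos by (auto simp: t_def divide_simps)
  have "0 \<le> t * (c + t * d)"
    using ge[OF t] by (simp add: algebra_simps power2_eq_square)
  then have "0 \<le> c + t * d"
    using t by (simp add: zero_le_mult_iff)
  moreover have "c + t * d = t * c"
    using pos by (simp add: t_def field_simps)
  ultimately show False
    using mult_pos_neg[OF t(1) c] by simp
qed

text \<open>First-order optimality without differentiating \<open>h\<close>: a linear bound of slope
  \<open>k\<close> along the segment suffices. It is applied with \<open>k = h u\<close> for
  arbitrary \<open>u\<close>, and with \<open>k = - h b\<close> for \<open>u = - b\<close>.\<close>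

lemma arg_min_directional:
  fixes X :: "real ^ 'p ^ 'n"
  assumes min: "is_arg_min (\<lambda>\<beta>. (norm (X *v \<beta> - y))\<^sup>2 + 2 * h \<beta>) (\<lambda>\<beta>. True) b"
    and h: "\<And>t. 0 < t \<Longrightarrow> t \<le> 1 \<Longrightarrow> h (b + t *\<^sub>R u) \<le> h b + t * k"
  shows "(y - X *v b) \<bullet> (X *v u) \<le> k"
proof -
  have "0 \<le> t * (2 * (k - (y - X *v b) \<bullet> (X *v u))) + t\<^sup>2 * (norm (X *v u))\<^sup>2"
    if t: "0 < t" "t \<le> 1" for t
  proof -
    have "(norm (X *v b - y))\<^sup>2 + 2 * h b
        \<le> (norm (X *v (b + t *\<^sub>R u) - y))\<^sup>2 + 2 * h (b + t *\<^sub>R u)"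
      using min by (simp add: is_arg_min_linorder)
    also have "X *v (b + t *\<^sub>R u) - y = (X *v b - y) + t *\<^sub>R (X *v u)"
      by (simp add: matrix_vector_right_distrib matrix_vector_mult_scaleR)
    \<comment> \<open>The constant term of this expansion cancels against the loss at
      \<open>b\<close>, leaving a quadratic in \<open>t\<close> that vanishes at
      \<open>0\<close>.\<close>
    also have "(norm ((X *v b - y) + t *\<^sub>R (X *v u)))\<^sup>2
        = (norm (X *v b - y))\<^sup>2 - 2 * t * ((y - X *v b) \<bullet> (X *v u)) + t\<^sup>2 * (norm (X *v u))\<^sup>2"
      unfolding power2_norm_eq_inner
      by (simp add: inner_simps inner_commute power2_eq_square algebra_simps)
    finally show ?thesis
      using h[OF t] by (simp add: algebra_simps)
  qed
  from nonneg_of_quadratic_nonneg[OF _ this] show ?thesis by simp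
qed

lemma bdd_above_noise_barrier:
  fixes X :: "real ^ 'p ^ 'n"
  assumes "\<And>u. 0 \<le> h u"
  shows "bdd_above ((\<lambda>u. e \<bullet> (X *v u) - h u) ` {u. norm (X *v u) \<le> 1})"
proof (rule bdd_aboveI2)
  fix u assume "u \<in> {u. norm (X *v u) \<le> 1}"
  then have "norm e * norm (X *v u) \<le> norm e"
    by (simp add: mult_left_le)
  then show "e \<bullet> (X *v u) - h u \<le> norm e"
    using norm_cauchy_schwarz[of e "X *v u"] assms[of u] by linarith
qed

lemma noise_barrier_ge:
  assumes "\<And>u. 0 \<le> h u" and "norm (X *v u) \<le> 1"
  shows "e \<bullet> (X *v u) - h u \<le> noise_barrier X h e"
  unfolding noise_barrier_def
  by (rule cSUP_upper[OF _ bdd_above_noise_barrier]) (use assms in auto)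

lemma noise_barrier_le:
  assumes "\<And>u. norm (X *v u) \<le> 1 \<Longrightarrow> e \<bullet> (X *v u) - h u \<le> c"
  shows "noise_barrier X h e \<le> c"
  unfolding noise_barrier_def
proof (rule cSUP_least)
  have "0 \<in> {u. norm (X *v u) \<le> 1}" by simp
  then show "{u. norm (X *v u) \<le> 1} \<noteq> {}" by blast
qed (use assms in auto)

text \<open>The admissible set does not depend on the penalty, so a larger penalty lowers every
  term. Nonnegativity of \<open>g\<close> bounds the larger supremum.\<close>

lemma noise_barrier_antimono:
  assumes "\<And>u. 0 \<le> g u" and "\<And>u. g u \<le> h u"
  shows "noise_barrier X h e \<le> noise_barrier X g e"
proof (rule noise_barrier_le)
  fix u assume "norm (X *v u) \<le> 1"
  then show "e \<bullet> (X *v u) - h u \<le> noise_barrier X g e"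
    using noise_barrier_ge[of g X u e] assms(1) assms(2)[of u] by force
qed

lemma noise_barrier_le_loss:
  fixes X :: "real ^ 'p ^ 'n"
  assumes h: "is_seminorm h"
    and min: "is_arg_min (\<lambda>\<beta>. (norm (X *v \<beta> - (X *v b0 + e)))\<^sup>2 + 2 * h \<beta>) (\<lambda>\<beta>. True) b"
  shows "noise_barrier X h e \<le> norm (X *v (b - b0))"
proof (rule noise_barrier_le)
  fix u assume u: "norm (X *v u) \<le> 1"
  have "h (b + t *\<^sub>R u) \<le> h b + t * h u" if "0 < t" for t
    using h that unfolding is_seminorm_def by (metis abs_of_pos)
  from arg_min_directional[OF min this]
  have "(X *v b0 + e - X *v b) \<bullet> (X *v u) \<le> h u" .
  then have "e \<bullet> (X *v u) - h u \<le> (X *v (b - b0)) \<bullet> (X *v u)"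
    by (simp add: matrix_vector_mult_diff_distrib inner_simps)
  also have "\<dots> \<le> norm (X *v (b - b0)) * norm (X *v u)"
    by (rule norm_cauchy_schwarz)
  also have "\<dots> \<le> norm (X *v (b - b0))"
    using u by (simp add: mult_left_le)
  finally show "e \<bullet> (X *v u) - h u \<le> norm (X *v (b - b0))" .
qed

lemma loss_le_noise_barrier:
  fixes X :: "real ^ 'p ^ 'n"
  assumes h: "is_seminorm h"
    and min: "is_arg_min (\<lambda>\<beta>. (norm (X *v \<beta> - e))\<^sup>2 + 2 * h \<beta>) (\<lambda>\<beta>. True) b"
  shows "norm (X *v b) \<le> noise_barrier X h e"
proof -
  have nonneg: "\<And>u. 0 \<le> h u" and scale: "\<And>a u. h (a *\<^sub>R u) = \<bar>a\<bar> * h u"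
    using h by (auto simp: is_seminorm_def)
  \<comment> \<open>The left argument is \<open>(1 - t) *\<^sub>R b\<close>, and
    \<open>1 - t \<ge> 0\<close> removes the absolute value; hence the restriction to
    \<open>t \<le> 1\<close>.\<close>
  have "h (b + t *\<^sub>R (- b)) \<le> h b + t * (- h b)" if "t \<le> 1" for t
    using scale[of "1 - t" b] that by (simp add: algebra_simps)
  from arg_min_directional[OF min this]
  have "(e - X *v b) \<bullet> (X *v (- b)) \<le> - h b" .
  moreover have "X *v (- b) = - (X *v b)"
    using matrix_vector_mult_scaleR[of X "-1" b] by simp
  ultimately have key: "(norm (X *v b))\<^sup>2 \<le> e \<bullet> (X *v b) - h b"
    by (simp add: power2_norm_eq_inner inner_simps)
  \<comment> \<open>If \<open>X *v b = 0\<close>, then \<open>a = 0\<close> and \<open>0\<close> serves as the witness.\<close>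
  define a where "a = inverse (norm (X *v b))"
  have a: "0 \<le> a" "norm (X *v (a *\<^sub>R b)) \<le> 1"
    by (auto simp: a_def matrix_vector_mult_scaleR divide_simps)
  have "norm (X *v b) = a * (norm (X *v b))\<^sup>2"
    by (simp add: a_def power2_eq_square field_simps)
  also have "\<dots> \<le> a * (e \<bullet> (X *v b) - h b)"
    using key a(1) by (rule mult_left_mono)
  also have "\<dots> = e \<bullet> (X *v (a *\<^sub>R b)) - h (a *\<^sub>R b)"
    using a(1) by (simp add: scale matrix_vector_mult_scaleR algebra_simps)
  also have "\<dots> \<le> noise_barrier X h e"
    using nonneg a(2) by (rule noise_barrier_ge)
  finally show ?thesis .
qed

theorem proposition2p1:
  fixes X :: "real ^ 'p ^ 'n"
    and \<beta>star :: "real ^ 'p"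
    and \<epsilon> y :: "real ^ 'n"
  assumes y: "y = X *v \<beta>star + \<epsilon>"
  shows
    "(\<forall>(h :: real ^ 'p \<Rightarrow> real) \<beta>hat.
        is_seminorm h \<and>
        is_arg_min (\<lambda>\<beta>. (norm (X *v \<beta> - y))\<^sup>2 + 2 * h \<beta>) (\<lambda>\<beta>. True) \<beta>hat \<longrightarrow>
          noise_barrier X h \<epsilon> \<le> norm (X *v (\<beta>hat - \<beta>star)) \<and>
          (X *v \<beta>star = 0 \<longrightarrow> noise_barrier X h \<epsilon> = norm (X *v (\<beta>hat - \<beta>star)))) \<and>
     (\<forall>N :: real ^ 'p \<Rightarrow> real.
        is_norm N \<longrightarrow>
          antimono_on {0..} (\<lambda>l. noise_barrier X (\<lambda>\<beta>. l * N \<beta>) \<epsilon>))"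
proof (intro conjI allI impI; (elim conjE)?)
  fix h :: "real ^ 'p \<Rightarrow> real" and \<beta>hat
  assume h: "is_seminorm h"
    and min: "is_arg_min (\<lambda>\<beta>. (norm (X *v \<beta> - y))\<^sup>2 + 2 * h \<beta>) (\<lambda>\<beta>. True) \<beta>hat"
  show upper: "noise_barrier X h \<epsilon> \<le> norm (X *v (\<beta>hat - \<beta>star))"
    using noise_barrier_le_loss[OF h] min y by simp
  assume "X *v \<beta>star = 0"
  \<comment> \<open>Here \<open>y = \<epsilon>\<close> and the loss reduces to
    \<open>norm (X *v \<beta>hat)\<close>.\<close>
  then show "noise_barrier X h \<epsilon> = norm (X *v (\<beta>hat - \<beta>star))"
    using loss_le_noise_barrier[OF h, of X \<epsilon> \<beta>hat] min y upper
    by (simp add: matrix_vector_mult_diff_distrib)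
next
  fix N :: "real ^ 'p \<Rightarrow> real"
  assume "is_norm N"
  then have "\<And>u. 0 \<le> N u"
    by (simp add: is_norm_def is_seminorm_def)
  \<comment> \<open>For \<open>0 \<le> l \<le> l'\<close>, the penalties are nonnegative and
    pointwise ordered.\<close>
  then show "antimono_on {0..} (\<lambda>l. noise_barrier X (\<lambda>\<beta>. l * N \<beta>) \<epsilon>)"
    by (intro monotone_onI noise_barrier_antimono) (auto intro: mult_right_mono)
qed

end
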